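(* Let $\mathcal{M}$ be a chromatic moment functional. For all $f\in\mathbf{L}^2_{\mathcal{M}}$ and all $t\in\mathbb{R}$ the sum $\sum_{n=0}^{\infty}|\mathcal{K}^n[f](t)|^2$ converges, and its value is independent of $t$.
   Context: $\mathcal{M}$ is a linear functional on real polynomials in $\omega$ with moments $\mu_n=\mathcal{M}(\omega^n)$, assumed positive definite (all Hankel determinants $\det(\mu_{i+j})_{0\le i,j\le n}$ are positive), symmetric ($\mu_{2n+1}=0$ for all $n$) and normalized ($\mu_0=1$). $\mathcal{M}$ is called chromatic if moreover the sequence $\mu_n^{1/n}/n$ is bounded; then $\rho=\limsup_{n\to\infty}(\mu_n/n!)^{1/n}<\infty$, with the convention $1/\rho=\infty$ if $\rho=0$. $P_n^{\mathcal{M}}$ are the orthonormal polynomials with respect to $\mathcal{M}$ ($\mathcal{M}(P_n^{\mathcal M}P_m^{\mathcal M})=\delta(m-n)$, $\deg P_n^{\mathcal M}=n$, positive leading coefficients, $P_0^{\mathcal M}=1$), and $\mathcal{K}^n=i^{-n}P_n^{\mathcal{M}}(iD)$, $D$ being differentiation (each $\omega^k$ in $P_n^{\mathcal M}(\omega)$ is replaced by $i^kD^k$). For $0<b\le\infty$, $S(b)=\{z\in\mathbb{C}:|\mathrm{Im}\,z|<b\}$. $\mathbf{L}^2_{\mathcal{M}}$ is the vector space of functions $f:S(\frac{1}{2\rho})\to\mathbb{C}$ which are analytic on $S(\frac{1}{2\rho})$ and satisfy $\sum_{n=0}^{\infty}|\mathcal{K}^n[f](0)|^2<\infty$. *)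

theory Defs
  imports "HOL-Complex_Analysis.Complex_Analysis" "Jordan_Normal_Form.Determinant"
begin

definition moment :: "(real poly \<Rightarrow> real) \<Rightarrow> nat \<Rightarrow> real" where
  "moment M n = M (monom 1 n)"

text \<open>Both HOL-Analysis and Jordan_Normal_Form provide \<open>det\<close>; the Hankel matrices have varying
  size, so the latter one is meant.\<close>

definition hankel_det :: "(real poly \<Rightarrow> real) \<Rightarrow> nat \<Rightarrow> real" where
  "hankel_det M n = Determinant.det (Matrix.mat (Suc n) (Suc n) (\<lambda>(i, j). moment M (i + j)))"

definition positive_definite :: "(real poly \<Rightarrow> real) \<Rightarrow> bool" where
  "positive_definite M \<longleftrightarrow> (\<forall>n. hankel_det M n > 0)"

definition symmetric_functional :: "(real poly \<Rightarrow> real) \<Rightarrow> bool" where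
  "symmetric_functional M \<longleftrightarrow> (\<forall>n. moment M (2 * n + 1) = 0)"

definition normalized_functional :: "(real poly \<Rightarrow> real) \<Rightarrow> bool" where
  "normalized_functional M \<longleftrightarrow> moment M 0 = 1"

text \<open>Type \<open>real poly\<close> is not an instance of \<open>real_vector\<close>, whence the explicit scalar
  multiplications in the linearity condition. The index \<open>n = 0\<close>, for which the quotient below is
  \<open>0\<close> by convention, does not affect boundedness.\<close>

definition chromatic :: "(real poly \<Rightarrow> real) \<Rightarrow> bool" where
  "chromatic M \<longleftrightarrow>
     Vector_Spaces.linear Polynomial.smult (*) M \<and>
     positive_definite M \<and> symmetric_functional M \<and> normalized_functional M \<and>
     Bseq (\<lambda>n. root n (moment M n) / real n)"

definition rho :: "(real poly \<Rightarrow> real) \<Rightarrow> ereal" where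
  "rho M = limsup (\<lambda>n. ereal (root n (moment M n / fact n)))"

definition orthonormal_polys :: "(real poly \<Rightarrow> real) \<Rightarrow> (nat \<Rightarrow> real poly) \<Rightarrow> bool" where
  "orthonormal_polys M P \<longleftrightarrow>
     (\<forall>n m. M (P n * P m) = (if m = n then 1 else 0)) \<and>
     (\<forall>n. degree (P n) = n \<and> lead_coeff (P n) > 0) \<and>
     P 0 = 1"

text \<open>For a positive definite normalized functional the orthonormal sequence exists and is unique.\<close>

definition orth_poly :: "(real poly \<Rightarrow> real) \<Rightarrow> nat \<Rightarrow> real poly" where
  "orth_poly M = (THE P. orthonormal_polys M P)"

definition poly_iD :: "real poly \<Rightarrow> (complex \<Rightarrow> complex) \<Rightarrow> complex \<Rightarrow> complex" where
  "poly_iD p f z = (\<Sum>k\<le>degree p. of_real (Polynomial.coeff p k) * \<i> ^ k * (deriv ^^ k) f z)"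

definition chromatic_deriv ::
    "(real poly \<Rightarrow> real) \<Rightarrow> nat \<Rightarrow> (complex \<Rightarrow> complex) \<Rightarrow> complex \<Rightarrow> complex" where
  "chromatic_deriv M n f z = \<i> powi (- int n) * poly_iD (orth_poly M n) f z"

definition strip :: "ereal \<Rightarrow> complex set" where
  "strip b = {z. ereal \<bar>Im z\<bar> < b}"

text \<open>Functions on the strip are represented by total functions; values outside the strip are
  arbitrary. In \<^typ>\<open>ereal\<close> one has \<open>1 / 0 = \<infinity>\<close>, so \<open>rho M = 0\<close> yields the whole plane.\<close>

definition L2 :: "(real poly \<Rightarrow> real) \<Rightarrow> (complex \<Rightarrow> complex) set" where
  "L2 M = {f. f analytic_on strip (1 / (2 * rho M)) \<and>
              summable (\<lambda>n. (cmod (chromatic_deriv M n f 0))\<^sup>2)}"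

end

theory Submission imports Defs
begin

text \<open>For real \<open>t\<close> let \<open>\<Lambda>\<^sub>t(p)\<close> be the value at \<open>t\<close> of \<open>p(iD)\<close> applied to \<open>f\<close>, for complex polynomials \<open>p\<close>.
  The sum of the \<open>|\<Lambda>\<^sub>t(P\<^sub>n)|\<^sup>2\<close> is the square of the norm of \<open>\<Lambda>\<^sub>t\<close> with respect to the inner product
  \<open>(p, q) \<mapsto> M (p q*)\<close>. By Taylor expansion \<open>\<Lambda>\<^sub>t(p)\<close> is the limit of \<open>\<Lambda>\<^sub>s(p e\<^sub>N)\<close>, where \<open>e\<^sub>N\<close> is the
  \<open>N\<close>-th partial sum of \<open>exp (-i(t - s)\<omega>)\<close>. The moments grow at most like \<open>A\<^sup>n n!\<close>, so for small
  \<open>|t - s|\<close> the norm of \<open>p e\<^sub>N\<close> tends to that of \<open>p\<close>: multiplication by the exponential is isometric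
  in the limit. Hence the norm of \<open>\<Lambda>\<^sub>t\<close> is at most that of \<open>\<Lambda>\<^sub>s\<close>, and equality follows by exchanging
  \<open>s\<close> and \<open>t\<close>. Since the admissible step is uniform in \<open>s\<close>, finitely many steps reach every real
  point.\<close>

subsection \<open>Linear functionals on polynomials\<close>

text \<open>The functional that sends the \<open>k\<close>-th power of the variable to
  \<open>a k\<close>. Both functionals of the argument have this shape: \<open>M\<close>, with its
  moments as \<open>a\<close>, and evaluation of \<open>p(iD)f\<close> at \<open>z\<close>, with
  \<open>a k = \<i> ^ k * (deriv ^^ k) f z\<close>. The generic coefficient ring covers real and
  complex polynomials alike.\<close>

definition lin_ext :: "(nat \<Rightarrow> 'a::comm_ring_1) \<Rightarrow> 'a poly \<Rightarrow> 'a" where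
  "lin_ext a p = (\<Sum>k\<le>degree p. Polynomial.coeff p k * a k)"

lemma lin_ext_upto:
  assumes "degree p \<le> n"
  shows "lin_ext a p = (\<Sum>k\<le>n. Polynomial.coeff p k * a k)"
  unfolding lin_ext_def
  by (rule sum.mono_neutral_left) (use assms in \<open>auto simp: coeff_eq_0\<close>)

lemma lin_ext_0 [simp]: "lin_ext a 0 = 0"
  by (simp add: lin_ext_def)

lemma lin_ext_add: "lin_ext a (p + q) = lin_ext a p + lin_ext a q"
proof -
  let ?n = "max (degree p) (degree q)"
  have "degree (p + q) \<le> ?n" by (rule degree_add_le_max)
  then show ?thesis
    by (simp add: lin_ext_upto[of _ ?n] sum.distrib ring_distribs)
qed

lemma lin_ext_smult: "lin_ext a (Polynomial.smult c p) = c * lin_ext a p"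
  using degree_smult_le[of c p]
  by (simp add: lin_ext_upto[of _ "degree p"] sum_distrib_left mult.assoc)

lemma lin_ext_diff: "lin_ext a (p - q) = lin_ext a p - lin_ext a q"
  using lin_ext_add[of a "p - q" q] by simp

lemma lin_ext_sum: "lin_ext a (\<Sum>i\<in>I. p i) = (\<Sum>i\<in>I. lin_ext a (p i))"
  by (induction I rule: infinite_finite_induct) (auto simp: lin_ext_add)

lemma lin_ext_monom: "lin_ext a (Polynomial.monom c n) = c * a n"
proof -
  have "lin_ext a (Polynomial.monom c n) = (\<Sum>k\<le>n. if k = n then c * a k else 0)"
    unfolding lin_ext_upto[OF degree_monom_le] by (rule sum.cong) auto
  then show ?thesis by simp
qed

lemma lin_ext_mult:
  assumes "degree p \<le> m" "degree q \<le> n"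
  shows "lin_ext a (p * q) =
    (\<Sum>i\<le>m. \<Sum>j\<le>n. Polynomial.coeff p i * Polynomial.coeff q j * a (i + j))"
proof -
  have "p * q = (\<Sum>i\<le>m. Polynomial.monom (Polynomial.coeff p i) i) *
                (\<Sum>j\<le>n. Polynomial.monom (Polynomial.coeff q j) j)"
    using assms by (simp add: poly_as_sum_of_monoms')
  also have "\<dots> = (\<Sum>i\<le>m. \<Sum>j\<le>n.
      Polynomial.monom (Polynomial.coeff p i * Polynomial.coeff q j) (i + j))"
    by (simp add: sum_product mult_monom)
  finally show ?thesis by (simp add: lin_ext_sum lin_ext_monom)
qed

lemma lin_ext_moment:
  assumes "Vector_Spaces.linear Polynomial.smult (*) M"
  shows "lin_ext (moment M) p = M p"
proof -
  interpret Vector_Spaces.linear Polynomial.smult "(*)" M by (rule assms)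
  have "M p = M (\<Sum>k\<le>degree p. Polynomial.smult (Polynomial.coeff p k) (Polynomial.monom 1 k))"
    by (simp add: smult_monom poly_as_sum_of_monoms)
  also have "\<dots> = lin_ext (moment M) p"
    by (simp add: sum scale lin_ext_def moment_def)
  finally show ?thesis ..
qed

lemma poly_basis_expansion:
  fixes B :: "nat \<Rightarrow> 'a::field poly"
  assumes "\<And>k. degree (B k) = k" "\<And>k. B k \<noteq> 0" and "degree p \<le> n"
  shows "\<exists>c. p = (\<Sum>k\<le>n. Polynomial.smult (c k) (B k))"
  using assms(3)
proof (induction n arbitrary: p)
  case 0
  then obtain d where d: "p = [:d:]" by (auto elim: degree_eq_zeroE)
  obtain b where b: "B 0 = [:b:]" using assms(1)[of 0] by (auto elim: degree_eq_zeroE)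
  then have "b \<noteq> 0" using assms(2)[of 0] by auto
  with d b have "p = Polynomial.smult (d / b) (B 0)" by simp
  then show ?case by auto
next
  case (Suc n)
  \<comment> \<open>This multiple of \<open>B (Suc n)\<close> cancels the top coefficient of
    \<open>p\<close>, so the remainder has degree at most \<open>n\<close>.\<close>
  let ?c = "Polynomial.coeff p (Suc n) / lead_coeff (B (Suc n))"
  let ?q = "p - Polynomial.smult ?c (B (Suc n))"
  have "degree ?q \<le> Suc n"
    by (intro degree_diff_le Suc.prems order.trans[OF degree_smult_le]) (simp add: assms)
  moreover have "Polynomial.coeff ?q (Suc n) = 0"
    using assms(1)[of "Suc n"] assms(2)[of "Suc n"] leading_coeff_0_iff[of "B (Suc n)"] by auto
  ultimately have "degree ?q \<le> n"
    by (metis Suc_leI le_SucE leading_coeff_0_iff degree_0 not_less_eq_eq zero_le)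
  then obtain c where c: "?q = (\<Sum>k\<le>n. Polynomial.smult (c k) (B k))"
    using Suc.IH by blast
  have "p = ?q + Polynomial.smult ?c (B (Suc n))" by simp
  also have "\<dots> = (\<Sum>k\<le>Suc n. Polynomial.smult ((c(Suc n := ?c)) k) (B k))"
    unfolding c by simp
  finally show ?case by blast
qed

subsection \<open>Existence and uniqueness of the orthonormal polynomials\<close>

text \<open>The Hankel matrix is congruent, via the triangular matrix of coefficients, to the diagonal
  Gram matrix of an orthogonal system.\<close>

lemma hankel_det_orthogonal:
  assumes deg: "\<And>k. k \<le> n \<Longrightarrow> degree (B k) = k"
    and orth: "\<And>k l. k \<le> n \<Longrightarrow> l \<le> n \<Longrightarrow> k \<noteq> l \<Longrightarrow> lin_ext (moment M) (B k * B l) = 0"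
  shows "(\<Prod>k\<le>n. lead_coeff (B k))\<^sup>2 * hankel_det M n = (\<Prod>k\<le>n. lin_ext (moment M) (B k * B k))"
proof -
  let ?N = "Suc n"
  define H where "H = Matrix.mat ?N ?N (\<lambda>(i, j). moment M (i + j))"
  define C where "C = Matrix.mat ?N ?N (\<lambda>(k, i). Polynomial.coeff (B k) i)"
  define D where "D = Matrix.mat ?N ?N (\<lambda>(k, l). lin_ext (moment M) (B k * B l))"
  have carr: "H \<in> carrier_mat ?N ?N" "C \<in> carrier_mat ?N ?N" "D \<in> carrier_mat ?N ?N"
    by (auto simp: H_def C_def D_def)
  have "C * H * transpose_mat C = D"
  proof (rule eq_matI)
    fix k l assume "k < dim_row D" "l < dim_col D"
    then have kl: "k < ?N" "l < ?N" by (auto simp: D_def)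
    have "(C * H * transpose_mat C) $$ (k, l) =
      (\<Sum>j<?N. (\<Sum>i<?N. Polynomial.coeff (B k) i * moment M (i + j)) * Polynomial.coeff (B l) j)"
      using kl by (simp add: C_def H_def scalar_prod_def lessThan_atLeast0)
    also have "\<dots> = (\<Sum>i\<le>n. \<Sum>j\<le>n. Polynomial.coeff (B k) i * Polynomial.coeff (B l) j * moment M (i + j))"
      unfolding lessThan_Suc_atMost sum_distrib_right
      by (subst sum.swap) (simp add: mult_ac)
    also have "\<dots> = lin_ext (moment M) (B k * B l)"
      using kl deg by (subst lin_ext_mult[of _ n _ n]) auto
    finally show "(C * H * transpose_mat C) $$ (k, l) = D $$ (k, l)"
      using kl by (simp add: D_def)
  qed (auto simp: C_def D_def)
  moreover have "Determinant.det (C * H * transpose_mat C) = (Determinant.det C)\<^sup>2 * Determinant.det H"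
    using carr by (simp add: Determinant.det_mult[of _ ?N] Determinant.det_transpose[of _ ?N]
        power2_eq_square)
  moreover have "Determinant.det C = (\<Prod>k\<le>n. lead_coeff (B k))"
  proof -
    have "Determinant.det C = prod_list (diag_mat C)"
      by (rule det_lower_triangular[OF _ carr(2)]) (auto simp: C_def deg coeff_eq_0)
    also have "\<dots> = (\<Prod>k\<le>n. lead_coeff (B k))"
      unfolding prod_list_diag_prod
      by (rule prod.cong) (auto simp: C_def deg)
    finally show ?thesis .
  qed
  moreover have "Determinant.det D = (\<Prod>k\<le>n. lin_ext (moment M) (B k * B k))"
  proof -
    have "Determinant.det D = prod_list (diag_mat D)"
      by (rule det_lower_triangular[OF _ carr(3)]) (auto simp: D_def orth)
    also have "\<dots> = (\<Prod>k\<le>n. lin_ext (moment M) (B k * B k))"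
      unfolding prod_list_diag_prod
      by (rule prod.cong) (auto simp: D_def)
    finally show ?thesis .
  qed
  moreover have "hankel_det M n = Determinant.det H"
    by (simp add: hankel_det_def H_def)
  ultimately show ?thesis by simp
qed

text \<open>For arbitrary \<open>a\<close> the radicand may fail to be positive, and the values then
  carry no meaning; positivity is proved below from the Hankel determinants. The equation leaves the
  simpset because it would unfold endlessly under the sum.\<close>

fun gram_schmidt :: "(nat \<Rightarrow> real) \<Rightarrow> nat \<Rightarrow> real poly" where
  "gram_schmidt a n =
     (let q = Polynomial.monom 1 n -
        (\<Sum>k<n. Polynomial.smult (lin_ext a (Polynomial.monom 1 n * gram_schmidt a k)) (gram_schmidt a k))
      in Polynomial.smult (1 / sqrt (lin_ext a (q * q))) q)"

declare gram_schmidt.simps [simp del]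

text \<open>Apart from the usual orthogonalisation the point is that the norm of the unnormalised
  \<open>q\<close> is positive: \<open>hankel_det_orthogonal\<close> expresses it as a positive
  square times a Hankel determinant.\<close>

lemma gram_schmidt_orthonormal:
  assumes pd: "\<And>n. hankel_det M n > 0"
  defines "a \<equiv> moment M" and "P \<equiv> gram_schmidt (moment M)"
  shows "degree (P n) = n \<and> lead_coeff (P n) > 0 \<and> (\<forall>k\<le>n. lin_ext a (P n * P k) = (if k = n then 1 else 0))"
proof (induction n rule: less_induct)
  case (less n)
  then have deg: "degree (P k) = k" and lc: "lead_coeff (P k) > 0" if "k < n" for k
    using less[OF that] by blast+
  have orth: "lin_ext a (P k * P l) = (if k = l then 1 else 0)" if "k < n" "l < n" for k l
    using less[of k] less[of l] that
    by (cases "k \<le> l") (simp add: mult.commute[of "P k" "P l"], simp)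
  define s where "s = (\<Sum>k<n. Polynomial.smult (lin_ext a (Polynomial.monom 1 n * P k)) (P k))"
  define q where "q = Polynomial.monom 1 n - s"
  have coeff_s: "Polynomial.coeff s m = 0" if "m \<ge> n" for m
    using that deg by (simp add: s_def coeff_sum coeff_eq_0)
  have degq: "degree q = n" and lq: "lead_coeff q = 1"
  proof -
    have "degree q \<le> n"
      by (rule degree_le) (auto simp: q_def coeff_s)
    moreover have "Polynomial.coeff q n = 1" by (simp add: q_def coeff_s)
    ultimately show "degree q = n" by (metis le_antisym le_degree zero_neq_one)
    with \<open>Polynomial.coeff q n = 1\<close> show "lead_coeff q = 1" by simp
  qed
  have qorth: "lin_ext a (q * P l) = 0" if "l < n" for l
  proof -
    have "lin_ext a (s * P l) = (\<Sum>k<n. lin_ext a (Polynomial.monom 1 n * P k) * (if k = l then 1 else 0))"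
      using that by (simp add: s_def sum_distrib_right lin_ext_sum lin_ext_smult orth)
    also have "\<dots> = (\<Sum>k<n. if k = l then lin_ext a (Polynomial.monom 1 n * P k) else 0)"
      by (rule sum.cong) auto
    finally show ?thesis using that by (simp add: q_def ring_distribs lin_ext_diff)
  qed
  \<comment> \<open>Only the last member is left unnormalised, so the product of squared norms
    collapses to \<open>lin_ext a (q * q)\<close>.\<close>
  let ?B = "P(n := q)"
  have "(\<Prod>k\<le>n. lead_coeff (?B k))\<^sup>2 * hankel_det M n = (\<Prod>k\<le>n. lin_ext (moment M) (?B k * ?B k))"
  proof (rule hankel_det_orthogonal)
    fix k l assume "k \<le> n" "l \<le> n" "k \<noteq> l"
    then consider "k < n" "l < n" | "k = n" "l < n" | "k < n" "l = n" by linarith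
    then show "lin_ext (moment M) (?B k * ?B l) = 0"
      using orth[of k l] qorth[of k] qorth[of l] \<open>k \<noteq> l\<close> unfolding a_def
      by cases (simp_all add: mult.commute[of _ q])
  qed (use deg degq in auto)
  also have "\<dots> = lin_ext a (q * q)"
    unfolding lessThan_Suc_atMost[symmetric] by (simp add: orth a_def[symmetric])
  finally have "lin_ext a (q * q) = (\<Prod>k\<le>n. lead_coeff (?B k))\<^sup>2 * hankel_det M n" ..
  moreover have "(\<Prod>k\<le>n. lead_coeff (?B k)) > 0"
    by (rule prod_pos) (use lc lq in auto)
  ultimately have pos: "lin_ext a (q * q) > 0"
    using pd[of n] by (metis mult_pos_pos zero_less_power)
  have P: "P n = Polynomial.smult (1 / sqrt (lin_ext a (q * q))) q"
    using gram_schmidt.simps[of a n] unfolding Let_def q_def s_def P_def a_def .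
  have "lin_ext a (P n * P k) = (if k = n then 1 else 0)" if "k \<le> n" for k
  proof (cases "k = n")
    case True
    then show ?thesis using pos by (simp add: P lin_ext_smult)
  next
    case False
    then have "lin_ext a (q * P k) = 0" using that qorth by simp
    then show ?thesis using False by (simp add: P lin_ext_smult)
  qed
  moreover have "degree (P n) = n" "lead_coeff (P n) > 0"
    using pos degq lq by (auto simp: P)
  ultimately show ?case by blast
qed


lemma orthonormal_polys_exist:
  assumes lin: "Vector_Spaces.linear Polynomial.smult (*) M"
    and "positive_definite M" "normalized_functional M"
  shows "orthonormal_polys M (gram_schmidt (moment M))"
proof -
  let ?P = "gram_schmidt (moment M)"
  have P: "degree (?P n) = n" "lead_coeff (?P n) > 0"
      "\<And>k. k \<le> n \<Longrightarrow> M (?P n * ?P k) = (if k = n then 1 else 0)" for n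
    using gram_schmidt_orthonormal[of M n] assms by (auto simp: positive_definite_def lin_ext_moment)
  have "M (?P n * ?P m) = (if m = n then 1 else 0)" for n m
    using P(3)[of m n] P(3)[of n m] by (cases "m \<le> n") (auto simp: mult.commute[of "?P n"])
  \<comment> \<open>The constant \<open>b\<close> satisfies \<open>b * b = 1\<close> because the
    zeroth moment is 1, and the positive leading coefficient fixes its sign.\<close>
  moreover have "?P 0 = 1"
  proof -
    obtain b where b: "?P 0 = [:b:]" using P(1)[of 0] by (auto elim: degree_eq_zeroE)
    have "lin_ext (moment M) [:b * b:] = 1"
      using P(3)[of 0 0] b by (simp add: lin_ext_moment lin)
    then have "b * b = 1"
      using assms(3) by (simp add: lin_ext_def normalized_functional_def)
    moreover have "b > 0" using P(2)[of 0] b by simp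
    ultimately have "b = 1" by (simp add: square_eq_1_iff)
    then show ?thesis by (simp add: b)
  qed
  ultimately show ?thesis using P(1,2) by (simp add: orthonormal_polys_def)
qed

text \<open>Expand \<open>Q n\<close> in the basis \<open>R\<close>, with coefficients
  \<open>M (Q n * R l)\<close>. For \<open>l < n\<close> induction gives \<open>R l = Q l\<close>,
  so these vanish; the remaining coefficient has square 1 and is positive.\<close>

lemma orthonormal_polys_unique:
  assumes lin: "Vector_Spaces.linear Polynomial.smult (*) M"
    and Q: "orthonormal_polys M Q" and R: "orthonormal_polys M R"
  shows "Q = R"
proof
  define a where "a = moment M"
  have M: "M p = lin_ext a p" for p
    using lin by (simp add: a_def lin_ext_moment)
  fix n
  show "Q n = R n"
  proof (induction n rule: less_induct)
    case (less n)
    have degR: "degree (R k) = k" "lead_coeff (R k) > 0" for k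
      using R unfolding orthonormal_polys_def by blast+
    then have R0: "R k \<noteq> 0" for k
      by (metis less_irrefl leading_coeff_0_iff)
    have degQ: "degree (Q n) = n" "lead_coeff (Q n) > 0"
      using Q unfolding orthonormal_polys_def by blast+
    obtain c where c: "Q n = (\<Sum>k\<le>n. Polynomial.smult (c k) (R k))"
      using poly_basis_expansion[of R "Q n" n] degR(1) R0 degQ(1) by auto
    have coeff: "M (Q n * R l) = c l" if "l \<le> n" for l
    proof -
      have "M (Q n * R l) = (\<Sum>k\<le>n. c k * M (R k * R l))"
        unfolding c
        by (simp add: M sum_distrib_right lin_ext_sum lin_ext_smult)
      also have "\<dots> = (\<Sum>k\<le>n. if k = l then c k else 0)"
        using R by (intro sum.cong) (auto simp: orthonormal_polys_def)
      finally show ?thesis using that by simp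
    qed
    have "c l = 0" if "l < n" for l
    proof -
      have "c l = M (Q n * Q l)" using coeff[of l] less that by simp
      also have "\<dots> = 0" using Q that by (simp add: orthonormal_polys_def)
      finally show ?thesis .
    qed
    then have Qn: "Q n = Polynomial.smult (c n) (R n)"
      unfolding c lessThan_Suc_atMost[symmetric] by simp
    have "M (Q n * Q n) = 1" using Q by (simp add: orthonormal_polys_def)
    moreover have "M (Q n * Q n) = c n * c n"
      using coeff[of n] by (subst (2) Qn) (simp add: M lin_ext_smult)
    moreover have "c n > 0"
      using degQ(2) degR[of n] by (simp add: Qn zero_less_mult_iff split: if_splits)
    ultimately have "c n = 1" by (simp add: square_eq_1_iff)
    then show ?case using Qn by simp
  qed
qed

text \<open>Existence and uniqueness together justify the definite description in
  \<open>orth_poly\<close>.\<close>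

lemma orthonormal_polys_orth_poly:
  assumes "chromatic M"
  shows "orthonormal_polys M (orth_poly M)"
proof -
  have M: "Vector_Spaces.linear Polynomial.smult (*) M" "positive_definite M" "normalized_functional M"
    using assms unfolding chromatic_def by blast+
  show ?thesis
    unfolding orth_poly_def
    by (rule theI[of "orthonormal_polys M", OF orthonormal_polys_exist[OF M]])
      (rule orthonormal_polys_unique[OF M(1) _ orthonormal_polys_exist[OF M]])
qed

subsection \<open>Growth of the moments\<close>

text \<open>The quotient of \<open>n ^ n\<close> by \<open>fact n\<close> is a single term of the
  exponential series at \<open>n\<close>.\<close>

lemma power_self_le_exp_fact: "real n ^ n \<le> exp 1 ^ n * fact n"
proof -
  have s: "(\<lambda>k. real n ^ k /\<^sub>R fact k) sums exp (real n)" by (rule exp_converges)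
  have "(\<Sum>k\<in>{n}. real n ^ k /\<^sub>R fact k) \<le> exp (real n)"
    unfolding sums_unique[OF s] by (rule sum_le_suminf) (use s in \<open>auto simp: sums_iff\<close>)
  then show ?thesis
    by (simp add: field_simps flip: exp_of_nat_mult)
qed

lemma chromatic_moment_bound:
  assumes "chromatic M"
  obtains A where "A > 0" "\<And>n. \<bar>moment M n\<bar> \<le> A ^ n * fact n"
proof -
  from assms obtain K where K: "K > 0" "\<And>n. norm (root n (moment M n) / real n) \<le> K"
    unfolding chromatic_def by (auto elim: BseqE)
  have "\<bar>moment M n\<bar> \<le> (K * exp 1) ^ n * fact n" for n
  \<comment> \<open>At index 0 the bounded quotient is 0 by convention and says nothing about the
    moment; normalization supplies the bound.\<close>
  proof (cases "n = 0")
    case True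
    then show ?thesis using assms by (simp add: chromatic_def normalized_functional_def)
  next
    case False
    then have "root n \<bar>moment M n\<bar> \<le> K * real n"
      using K(2)[of n] by (simp add: real_root_abs field_simps)
    then have "root n \<bar>moment M n\<bar> ^ n \<le> (K * real n) ^ n"
      using False by (intro power_mono) auto
    then have "\<bar>moment M n\<bar> \<le> K ^ n * real n ^ n"
      using False by (simp add: power_mult_distrib)
    also have "\<dots> \<le> K ^ n * (exp 1 ^ n * fact n)"
      using K(1) by (intro mult_left_mono power_self_le_exp_fact) auto
    finally show ?thesis by (simp add: power_mult_distrib mult.assoc)
  qed
  with K(1) show ?thesis by (intro that[of "K * exp 1"]) auto
qed

text \<open>The moment bound gives \<open>rho M \<le> A\<close>, so the half-width of the strip is
  at least \<open>1 / (2 * A)\<close>. Hence discs of one common radius around all real points lie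
  in the domain of analyticity.\<close>

lemma strip_contains_real_nbhd:
  assumes M: "chromatic M"
  obtains r where "r > 0" "\<And>z. \<bar>Im z\<bar> < r \<Longrightarrow> z \<in> strip (1 / (2 * rho M))"
proof -
  obtain A where A: "A > 0" "\<And>n. \<bar>moment M n\<bar> \<le> A ^ n * fact n"
    using chromatic_moment_bound[OF M] by blast
  have "rho M \<le> ereal A"
    unfolding rho_def
  proof (rule Limsup_bounded, rule eventually_sequentiallyI[of 1])
    fix n :: nat assume n: "1 \<le> n"
    have "moment M n / fact n \<le> A ^ n" using A(2)[of n] by (simp add: field_simps abs_le_iff)
    then have "root n (moment M n / fact n) \<le> root n (A ^ n)" using n by simp
    then show "ereal (root n (moment M n / fact n)) \<le> ereal A"
      using n A(1) by (simp add: real_root_power_cancel)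
  qed
  \<comment> \<open>The odd moments vanish, so the sequence is 0 infinitely often and its limsup
    cannot be negative.\<close>
  moreover have "rho M \<ge> 0"
  proof (rule ccontr)
    assume "\<not> rho M \<ge> 0"
    then have "\<forall>\<^sub>F n in sequentially. ereal (root n (moment M n / fact n)) < 0"
      unfolding rho_def not_le by (rule Limsup_lessD)
    then obtain N where N: "\<And>n. n \<ge> N \<Longrightarrow> ereal (root n (moment M n / fact n)) < 0"
      by (auto simp: eventually_sequentially)
    have "moment M (2 * N + 1) = 0"
      using M by (simp add: chromatic_def symmetric_functional_def)
    with N[of "2 * N + 1"] show False by simp
  qed
  ultimately obtain x where x: "rho M = ereal x" "0 \<le> x" "x \<le> A"
    by (cases "rho M") auto
  have "z \<in> strip (1 / (2 * rho M))" if "\<bar>Im z\<bar> < 1 / (2 * A)" for z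
  proof (cases "x = 0")
    case True
    then show ?thesis by (simp add: strip_def x(1) zero_ereal_def[symmetric] divide_ereal_def)
  next
    case False
    then have "1 / (2 * A) \<le> 1 / (2 * x)" using x A(1) by (simp add: frac_le)
    with that have "\<bar>Im z\<bar> < 1 / (2 * x)" by linarith
    moreover have "1 / (2 * rho M) = ereal (1 / (2 * x))"
      using False unfolding x(1) by (simp add: one_ereal_def numeral_eq_ereal)
    ultimately show ?thesis by (simp add: strip_def)
  qed
  with A(1) show ?thesis by (intro that[of "1 / (2 * A)"]) auto
qed

subsection \<open>Truncated exponentials\<close>

lemma coeff_map_poly_of_real [simp]:
  "Polynomial.coeff (map_poly complex_of_real p) k = of_real (Polynomial.coeff p k)"
  by (simp add: coeff_map_poly)

lemma coeff_map_poly_cnj [simp]: "Polynomial.coeff (map_poly cnj p) k = cnj (Polynomial.coeff p k)"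
  by (simp add: coeff_map_poly)

lemma map_poly_of_real_mult:
  "map_poly complex_of_real (p * q) = map_poly of_real p * map_poly of_real q"
  by (rule poly_eqI) (simp add: coeff_mult)

lemma map_poly_cnj_mult: "map_poly cnj (p * q) = map_poly cnj p * map_poly cnj q"
  by (rule poly_eqI) (simp add: coeff_mult)

lemma degree_map_poly_of_real: "degree (map_poly complex_of_real p) = degree p"
  by (cases "p = 0") (auto intro: map_poly_degree_eq)

lemma lin_ext_of_real:
  "lin_ext (\<lambda>k. complex_of_real (m k)) (map_poly of_real p) = of_real (lin_ext m p)"
  by (simp add: lin_ext_def degree_map_poly_of_real)

text \<open>Multiplication by the \<open>j\<close>-th power of the variable amounts to shifting the
  value sequence by \<open>j\<close>.\<close>

lemma lin_ext_mult_shift: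
  assumes "degree q \<le> n"
  shows "lin_ext a (p * q) = (\<Sum>j\<le>n. Polynomial.coeff q j * lin_ext (\<lambda>k. a (k + j)) p)"
  unfolding lin_ext_mult[OF order_refl assms]
  by (subst sum.swap) (simp add: lin_ext_def sum_distrib_left mult_ac)

text \<open>Taylor polynomial of exp(c\<omega>) in the variable \<omega>. It will be used with
  purely imaginary \<open>c\<close>, for which conjugation turns \<open>c\<close> into
  \<open>- c\<close>.\<close>

definition exp_poly :: "complex \<Rightarrow> nat \<Rightarrow> complex poly" where
  "exp_poly c N = (\<Sum>j\<le>N. Polynomial.monom (c ^ j / fact j) j)"

lemma coeff_exp_poly: "Polynomial.coeff (exp_poly c N) j = (if j \<le> N then c ^ j / fact j else 0)"
  by (simp add: exp_poly_def coeff_sum)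

lemma degree_exp_poly: "degree (exp_poly c N) \<le> N"
  by (rule degree_le) (simp add: coeff_exp_poly)

lemma map_poly_cnj_exp_poly: "map_poly cnj (exp_poly c N) = exp_poly (cnj c) N"
  by (rule poly_eqI) (simp add: coeff_exp_poly)

text \<open>The quotient of the factorials is a binomial coefficient, at most
  \<open>2 ^ (j + k)\<close>.\<close>

lemma fact_add_le: "fact (j + k) \<le> (2 ^ (j + k) * fact j * fact k :: real)"
proof -
  have "fact (j + k) = (fact j * fact k * of_nat ((j + k) choose j) :: real)"
    using binomial_fact_lemma[of j "j + k"] by (metis add_diff_cancel_left' le_add1 of_nat_fact of_nat_mult)
  also have "\<dots> \<le> fact j * fact k * 2 ^ (j + k)"
    by (intro mult_left_mono)
      (metis binomial_le_pow2 of_nat_le_iff of_nat_numeral of_nat_power, simp)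
  finally show ?thesis by (simp add: mult_ac)
qed

text \<open>These are the coefficients of exp(cx) exp(-cx) = 1; the binomial theorem turns the sum
  into a power of \<open>c + (- c)\<close>, which is 1 for exponent 0.\<close>

lemma sum_cauchy_exp_terms:
  fixes c :: complex
  shows "(\<Sum>j\<le>m. c ^ j / fact j * ((- c) ^ (m - j) / fact (m - j))) = (if m = 0 then 1 else 0)"
proof -
  have "(\<Sum>j\<le>m. c ^ j / fact j * ((- c) ^ (m - j) / fact (m - j))) =
        (\<Sum>j\<le>m. of_nat (m choose j) * c ^ j * (- c) ^ (m - j)) / fact m"
    unfolding sum_divide_distrib
    by (rule sum.cong) (auto simp: binomial_fact)
  also have "\<dots> = (c + (- c)) ^ m / fact m"
    by (simp only: binomial_ring)
  finally show ?thesis by (simp add: power_0_left)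
qed

text \<open>Splitting the factorial of \<open>k + n\<close> separates the two indices: the part in
  \<open>k\<close> is absorbed into \<open>K\<close>. A fixed polynomial \<open>g\<close> thus costs
  a constant and a doubling of the growth rate.\<close>

lemma lin_ext_shift_bound:
  fixes m :: "nat \<Rightarrow> complex"
  assumes A: "A > 0" "\<And>n. cmod (m n) \<le> A ^ n * fact n"
  obtains K where "K \<ge> 0" "\<And>n. cmod (lin_ext (\<lambda>k. m (k + n)) g) \<le> K * (2 * A) ^ n * fact n"
proof
  let ?K = "\<Sum>k\<le>degree g. cmod (Polynomial.coeff g k) * (2 * A) ^ k * fact k"
  show "?K \<ge> 0" using A(1) by (intro sum_nonneg) auto
  fix n
  have "cmod (lin_ext (\<lambda>k. m (k + n)) g) \<le> (\<Sum>k\<le>degree g. cmod (Polynomial.coeff g k) * cmod (m (k + n)))"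
    unfolding lin_ext_def by (rule order.trans[OF norm_sum]) (simp add: norm_mult)
  also have "\<dots> \<le> (\<Sum>k\<le>degree g. cmod (Polynomial.coeff g k) * ((2 * A) ^ k * fact k * ((2 * A) ^ n * fact n)))"
  proof (intro sum_mono mult_left_mono)
    fix k
    have "cmod (m (k + n)) \<le> A ^ (k + n) * fact (k + n)" by (rule A)
    also have "\<dots> \<le> A ^ (k + n) * (2 ^ (k + n) * fact k * fact n)"
      using A(1) by (intro mult_left_mono fact_add_le) auto
    finally show "cmod (m (k + n)) \<le> (2 * A) ^ k * fact k * ((2 * A) ^ n * fact n)"
      by (simp add: power_add power_mult_distrib mult_ac)
  qed auto
  also have "\<dots> = ?K * (2 * A) ^ n * fact n"
    by (simp add: sum_distrib_left mult_ac)
  finally show "cmod (lin_ext (\<lambda>k. m (k + n)) g) \<le> ?K * (2 * A) ^ n * fact n" .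
qed

text \<open>The term is the square of \<open>Suc n\<close> times the \<open>n\<close>-th power of
  \<open>sqrt x\<close>, which itself tends to 0.\<close>

lemma Suc_square_times_power_tendsto_0:
  fixes x :: real
  assumes "0 \<le> x" "x < 1"
  shows "(\<lambda>n. (real (Suc n))\<^sup>2 * x ^ n) \<longlonglongrightarrow> 0"
proof -
  let ?y = "sqrt x"
  have y: "norm ?y < 1" using assms by simp
  have "(\<lambda>n. (of_nat n * ?y ^ n + ?y ^ n)\<^sup>2) \<longlonglongrightarrow> (0 + 0)\<^sup>2"
    using y by (intro tendsto_intros powser_times_n_limit_0) auto
  moreover have "(of_nat n * ?y ^ n + ?y ^ n)\<^sup>2 = (real (Suc n))\<^sup>2 * x ^ n" for n
  proof -
    have "of_nat n * ?y ^ n + ?y ^ n = real (Suc n) * ?y ^ n"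
      by (simp add: algebra_simps)
    moreover have "(?y ^ n)\<^sup>2 = x ^ n"
      using assms by (metis power_commutes power_mult mult.commute real_sqrt_pow2)
    ultimately show ?thesis by (simp only: power_mult_distrib)
  qed
  ultimately show ?thesis by simp
qed

text \<open>The product of the truncated exponentials of \<open>c\<omega>\<close> and \<open>-c\<omega>\<close> is \<open>1\<close> up to terms of degree
  between \<open>N + 1\<close> and \<open>2N\<close>, whose moments are controlled by the growth condition.\<close>

lemma lin_ext_exp_poly_cancel:
  fixes m :: "nat \<Rightarrow> complex"
  assumes A: "A > 0" "\<And>n. cmod (m n) \<le> A ^ n * fact n"
    and c: "4 * A * cmod c < 1"
  shows "(\<lambda>N. lin_ext m (g * (exp_poly c N * exp_poly (- c) N))) \<longlonglongrightarrow> lin_ext m g"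
proof -
  obtain K where K: "K \<ge> 0" "\<And>n. cmod (lin_ext (\<lambda>k. m (k + n)) g) \<le> K * (2 * A) ^ n * fact n"
    using lin_ext_shift_bound[OF A] by blast
  \<comment> \<open>One factor 2 comes from the doubled rate in the shift bound, the other from
    splitting the factorial of \<open>j + l\<close>.\<close>
  define \<theta> where "\<theta> = 4 * A * cmod c"
  have \<theta>: "0 \<le> \<theta>" "\<theta> < 1" using A(1) c by (auto simp: \<theta>_def)
  define G where "G n = lin_ext (\<lambda>k. m (k + n)) g" for n
  define T where "T j l = c ^ j / fact j * ((- c) ^ l / fact l) * G (j + l)" for j l
  have eq: "lin_ext m (g * (exp_poly c N * exp_poly (- c) N)) = (\<Sum>(j, l)\<in>{..N} \<times> {..N}. T j l)" for N
  proof -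
    have "lin_ext m (g * (exp_poly c N * exp_poly (- c) N)) =
        (\<Sum>l\<le>N. (- c) ^ l / fact l * (\<Sum>j\<le>N. c ^ j / fact j * G (j + l)))"
      unfolding mult.assoc[symmetric] lin_ext_mult_shift[OF degree_exp_poly]
      by (simp add: coeff_exp_poly G_def add_ac)
    also have "\<dots> = (\<Sum>j\<le>N. \<Sum>l\<le>N. T j l)"
      by (subst sum.swap) (simp add: T_def sum_distrib_left mult_ac)
    finally show ?thesis by (simp add: sum.cartesian_product)
  qed
  \<comment> \<open>The triangle consists of complete Cauchy products, of which only the constant
    one survives.\<close>
  have low: "(\<Sum>(j, l)\<in>{(j, l). j + l \<le> N}. T j l) = lin_ext m g" for N
  proof -
    have "(\<Sum>(j, l)\<in>{(j, l). j + l \<le> N}. T j l) = (\<Sum>n\<le>N. \<Sum>j\<le>n. T j (n - j))"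
      by (rule sum.triangle_reindex_eq)
    also have "\<dots> = (\<Sum>n\<le>N. (\<Sum>j\<le>n. c ^ j / fact j * ((- c) ^ (n - j) / fact (n - j))) * G n)"
      unfolding T_def sum_distrib_right by (intro sum.cong) auto
    also have "\<dots> = (\<Sum>n\<le>N. if n = 0 then G 0 else 0)"
      unfolding sum_cauchy_exp_terms by (rule sum.cong) auto
    also have "\<dots> = lin_ext m g" by (simp add: G_def)
    finally show ?thesis .
  qed
  \<comment> \<open>The denominators \<open>fact j * fact l\<close> compensate the factorial growth
    of \<open>G\<close>, leaving geometric decay.\<close>
  have bound: "cmod (T j l) \<le> K * \<theta> ^ (j + l)" for j l
  proof -
    have "cmod (T j l) = cmod c ^ (j + l) / (fact j * fact l) * cmod (G (j + l))"
      by (simp add: T_def norm_mult norm_divide norm_power power_add)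
    also have "\<dots> \<le> cmod c ^ (j + l) / (fact j * fact l) * (K * (2 * A) ^ (j + l) * (2 ^ (j + l) * fact j * fact l))"
      using K A(1) unfolding G_def
      by (intro mult_left_mono order.trans[OF K(2)] fact_add_le) auto
    also have "\<dots> = K * (cmod c ^ (j + l) * (2 * A) ^ (j + l) * 2 ^ (j + l))"
    proof -
      have "x / (u * v) * (K * y * (z * u * v)) = K * (x * y * z)" if "u \<noteq> 0" "v \<noteq> 0" for x y z u v :: real
        using that by (simp add: field_simps)
      from this[OF fact_nonzero fact_nonzero] show ?thesis .
    qed
    also have "\<dots> = K * (cmod c * (2 * A) * 2) ^ (j + l)"
      by (simp only: power_mult_distrib)
    also have "cmod c * (2 * A) * 2 = \<theta>" by (simp add: \<theta>_def)
    finally show ?thesis .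
  qed
  \<comment> \<open>Outside the triangle \<open>j + l\<close> exceeds \<open>N\<close>, and the
    square has \<open>(Suc N)\<^sup>2\<close> index pairs.\<close>
  have diff: "cmod (lin_ext m (g * (exp_poly c N * exp_poly (- c) N)) - lin_ext m g)
      \<le> K * ((real (Suc N))\<^sup>2 * \<theta> ^ N)" for N
  proof -
    let ?S = "{..N} \<times> {..N}" and ?L = "{(j, l). j + l \<le> N}"
    have "?L \<subseteq> ?S" by auto
    then have "lin_ext m (g * (exp_poly c N * exp_poly (- c) N)) - lin_ext m g = (\<Sum>(j, l)\<in>?S - ?L. T j l)"
      unfolding eq low[of N, symmetric] by (subst sum_diff) auto
    also have "cmod \<dots> \<le> of_nat (card (?S - ?L)) * (K * \<theta> ^ N)"
    proof (rule sum_norm_bound, clarsimp)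
      fix j l assume "\<not> j + l \<le> N"
      then have "\<theta> ^ (j + l) \<le> \<theta> ^ N"
        using \<theta> by (intro power_decreasing) auto
      then show "cmod (T j l) \<le> K * \<theta> ^ N"
        using bound[of j l] K(1) by (meson mult_left_mono order.trans)
    qed
    also have "\<dots> \<le> of_nat ((Suc N)\<^sup>2) * (K * \<theta> ^ N)"
    proof (intro mult_right_mono of_nat_mono)
      have "card (?S - ?L) \<le> card ?S" by (intro card_mono) auto
      then show "card (?S - ?L) \<le> (Suc N)\<^sup>2" by (simp add: power2_eq_square)
    qed (use K \<theta> in auto)
    finally show ?thesis by (simp only: of_nat_power mult_ac)
  qed
  have "(\<lambda>N. K * ((real (Suc N))\<^sup>2 * \<theta> ^ N)) \<longlonglongrightarrow> K * 0"
    by (intro tendsto_mult_left Suc_square_times_power_tendsto_0 \<theta>)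
  then have "(\<lambda>N. lin_ext m (g * (exp_poly c N * exp_poly (- c) N)) - lin_ext m g) \<longlonglongrightarrow> 0"
    by (intro Lim_null_comparison[OF always_eventually[OF allI[OF diff]]]) simp
  then show ?thesis by (rule LIM_zero_cancel)
qed

text \<open>Substituting iD for \<omega> turns exp(-i(w - z)\<omega>) into exp((w - z)D), the
  translation from \<open>z\<close> to \<open>w\<close>. Only finitely many derivatives occur for
  fixed \<open>p\<close>, and each has a convergent Taylor series on the disc.\<close>

lemma lin_ext_exp_poly_taylor:
  assumes f: "f holomorphic_on ball z r" and w: "w \<in> ball z r"
  shows "(\<lambda>N. lin_ext (\<lambda>k. \<i> ^ k * (deriv ^^ k) f z) (p * exp_poly (- \<i> * (w - z)) N))
           \<longlonglongrightarrow> lin_ext (\<lambda>k. \<i> ^ k * (deriv ^^ k) f w) p"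
proof -
  have taylor: "(\<lambda>N. \<Sum>j\<le>N. (deriv ^^ (j + k)) f z / fact j * (w - z) ^ j) \<longlonglongrightarrow> (deriv ^^ k) f w" for k
  proof -
    have "(deriv ^^ k) f holomorphic_on ball z r"
      by (intro holomorphic_higher_deriv f) auto
    from holomorphic_power_series[OF this w] show ?thesis
      by (simp add: sums_def_le funpow_add)
  qed
  have eq: "lin_ext (\<lambda>k. \<i> ^ k * (deriv ^^ k) f z) (p * exp_poly (- \<i> * (w - z)) N) =
     (\<Sum>k\<le>degree p. Polynomial.coeff p k * (\<i> ^ k * (\<Sum>j\<le>N. (deriv ^^ (j + k)) f z / fact j * (w - z) ^ j)))" for N
  proof -
    have i: "\<i> ^ j * (- \<i> * (w - z)) ^ j = (w - z) ^ j" for j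
      by (simp add: power_mult_distrib[symmetric] flip: mult.assoc)
    have "Polynomial.coeff p k * Polynomial.coeff (exp_poly (- \<i> * (w - z)) N) j *
        (\<i> ^ (k + j) * (deriv ^^ (k + j)) f z) =
        Polynomial.coeff p k * (\<i> ^ k * ((deriv ^^ (j + k)) f z / fact j * (w - z) ^ j))"
      if "j \<le> N" for k j
      unfolding i[of j, symmetric] using that
      by (simp add: coeff_exp_poly power_add add.commute[of k j] mult_ac)
    then show ?thesis
      by (simp add: lin_ext_mult[OF order_refl degree_exp_poly] sum_distrib_left)
  qed
  show ?thesis
    unfolding eq lin_ext_def[of _ p] by (intro tendsto_intros taylor)
qed

subsection \<open>Norms of functionals and their invariance\<close>

text \<open>Finite Parseval identity. Since the \<open>Q k\<close> have real coefficients,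
  conjugation affects only the scalars \<open>c k\<close>.\<close>

lemma lin_ext_norm_orthonormal_sum:
  fixes Q :: "nat \<Rightarrow> complex poly"
  assumes real: "\<And>k. map_poly cnj (Q k) = Q k"
    and orth: "\<And>k l. lin_ext m (Q k * Q l) = (if k = l then 1 else 0)"
    and "finite I" and p: "p = (\<Sum>k\<in>I. Polynomial.smult (c k) (Q k))"
  shows "lin_ext m (p * map_poly cnj p) = of_real (\<Sum>k\<in>I. (cmod (c k))\<^sup>2)"
proof -
  have "map_poly cnj p = (\<Sum>k\<in>I. Polynomial.smult (cnj (c k)) (map_poly cnj (Q k)))"
    unfolding p by (rule poly_eqI) (simp add: coeff_sum)
  then have "map_poly cnj p = (\<Sum>k\<in>I. Polynomial.smult (cnj (c k)) (Q k))"
    by (simp only: real)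
  then have "lin_ext m (p * map_poly cnj p) = (\<Sum>k\<in>I. \<Sum>l\<in>I. c k * (cnj (c l) * lin_ext m (Q k * Q l)))"
    by (simp add: p sum_product lin_ext_sum lin_ext_smult mult_ac)
  also have "\<dots> = (\<Sum>k\<in>I. \<Sum>l\<in>I. if k = l then c k * cnj (c k) else 0)"
    by (intro sum.cong) (auto simp: orth)
  also have "\<dots> = (\<Sum>k\<in>I. c k * cnj (c k))"
    using assms(3) by simp
  finally show ?thesis by (simp add: complex_norm_square del: of_real_power)
qed

text \<open>Cauchy-Schwarz in the coordinates of \<open>p\<close> with respect to the orthonormal
  basis \<open>Q\<close>, followed by Parseval.\<close>

lemma lin_ext_bounded:
  fixes Q :: "nat \<Rightarrow> complex poly"
  assumes real: "\<And>k. map_poly cnj (Q k) = Q k"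
    and orth: "\<And>k l. lin_ext m (Q k * Q l) = (if k = l then 1 else 0)"
    and deg: "\<And>k. degree (Q k) = k"
    and sum: "summable (\<lambda>n. (cmod (lin_ext a (Q n)))\<^sup>2)"
  shows "(cmod (lin_ext a p))\<^sup>2 \<le> (\<Sum>n. (cmod (lin_ext a (Q n)))\<^sup>2) * Re (lin_ext m (p * map_poly cnj p))"
proof -
  have nz: "Q k \<noteq> 0" for k using orth[of k k] by auto
  obtain c where c: "p = (\<Sum>k\<le>degree p. Polynomial.smult (c k) (Q k))"
    using poly_basis_expansion[of Q p "degree p"] deg nz by auto
  let ?I = "{..degree p}"
  have "lin_ext a p = (\<Sum>k\<in>?I. c k * lin_ext a (Q k))"
    by (subst c) (simp add: lin_ext_sum lin_ext_smult)
  then have "cmod (lin_ext a p) \<le> (\<Sum>k\<in>?I. cmod (c k) * cmod (lin_ext a (Q k)))"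
    using norm_sum[of "\<lambda>k. c k * lin_ext a (Q k)" ?I] by (simp add: norm_mult)
  then have "(cmod (lin_ext a p))\<^sup>2 \<le> (\<Sum>k\<in>?I. cmod (c k) * cmod (lin_ext a (Q k)))\<^sup>2"
    by (intro power_mono) auto
  also have "\<dots> \<le> (\<Sum>k\<in>?I. (cmod (c k))\<^sup>2) * (\<Sum>k\<in>?I. (cmod (lin_ext a (Q k)))\<^sup>2)"
    by (rule Cauchy_Schwarz_ineq_sum)
  also have "\<dots> \<le> (\<Sum>k\<in>?I. (cmod (c k))\<^sup>2) * (\<Sum>n. (cmod (lin_ext a (Q n)))\<^sup>2)"
    by (intro mult_left_mono sum_le_suminf sum sum_nonneg) auto
  also have "(\<Sum>k\<in>?I. (cmod (c k))\<^sup>2) = Re (lin_ext m (p * map_poly cnj p))"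
    using lin_ext_norm_orthonormal_sum[OF real orth finite_atMost c] by simp
  finally show ?thesis by (simp add: mult.commute)
qed

text \<open>Converse of \<open>lin_ext_bounded\<close>. Testing the bound on the polynomial with
  coefficients \<open>cnj (lin_ext b (Q n))\<close> for \<open>n < N\<close>, both the value of the
  functional and the squared norm equal the partial sum \<open>s\<close>, so
  \<open>s\<^sup>2 \<le> S * s\<close>.\<close>

lemma summable_bessel:
  fixes Q :: "nat \<Rightarrow> complex poly"
  assumes real: "\<And>k. map_poly cnj (Q k) = Q k"
    and orth: "\<And>k l. lin_ext m (Q k * Q l) = (if k = l then 1 else 0)"
    and bound: "\<And>p. (cmod (lin_ext b p))\<^sup>2 \<le> S * Re (lin_ext m (p * map_poly cnj p))"
  shows "summable (\<lambda>n. (cmod (lin_ext b (Q n)))\<^sup>2)" "(\<Sum>n. (cmod (lin_ext b (Q n)))\<^sup>2) \<le> S"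
proof -
  \<comment> \<open>Test the bound on \<open>Q 0\<close>, which has norm 1.\<close>
  have S: "S \<ge> 0"
  proof -
    have "0 \<le> S * Re (lin_ext m (Q 0 * map_poly cnj (Q 0)))"
      by (rule order.trans[OF _ bound]) simp
    then show ?thesis by (simp add: real orth)
  qed
  have part: "(\<Sum>n<N. (cmod (lin_ext b (Q n)))\<^sup>2) \<le> S" for N
  proof -
    define s where "s = (\<Sum>n<N. (cmod (lin_ext b (Q n)))\<^sup>2)"
    define p where "p = (\<Sum>n<N. Polynomial.smult (cnj (lin_ext b (Q n))) (Q n))"
    have "s \<ge> 0" unfolding s_def by (intro sum_nonneg) auto
    have "lin_ext b p = of_real s"
      by (simp add: p_def s_def lin_ext_sum lin_ext_smult complex_norm_square mult.commute
          del: of_real_power)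
    moreover have "lin_ext m (p * map_poly cnj p) = of_real s"
      using lin_ext_norm_orthonormal_sum[OF real orth finite_lessThan p_def] by (simp add: s_def)
    ultimately have "s\<^sup>2 \<le> S * s" using bound[of p] by simp
    then have "s \<le> S"
      using \<open>s \<ge> 0\<close> S by (cases "s = 0") (auto simp: power2_eq_square)
    then show ?thesis by (simp add: s_def)
  qed
  show *: "summable (\<lambda>n. (cmod (lin_ext b (Q n)))\<^sup>2)"
    by (rule summableI_nonneg_bounded[OF _ part]) simp
  show "(\<Sum>n. (cmod (lin_ext b (Q n)))\<^sup>2) \<le> S"
    by (rule suminf_le_const[OF * part])
qed

text \<open>The bound for the functional at \<open>s\<close>, applied to
  \<open>p * exp_poly c N\<close>, passes to the limit: the left side by Taylor expansion, the right
  side by cancellation of the exponentials. Bessel then yields the sum at \<open>t\<close>.\<close>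

lemma lin_ext_deriv_sums_le:
  fixes Q :: "nat \<Rightarrow> complex poly" and s t :: real and f :: "complex \<Rightarrow> complex"
  defines "a \<equiv> (\<lambda>z k. \<i> ^ k * (deriv ^^ k) f z)"
  assumes real: "\<And>k. map_poly cnj (Q k) = Q k"
    and orth: "\<And>k l. lin_ext m (Q k * Q l) = (if k = l then 1 else 0)"
    and deg: "\<And>k. degree (Q k) = k"
    and A: "A > 0" "\<And>n. cmod (m n) \<le> A ^ n * fact n"
    and f: "f holomorphic_on ball (of_real s) r"
    and t: "\<bar>t - s\<bar> < r" "4 * A * \<bar>t - s\<bar> < 1"
    and sum: "summable (\<lambda>n. (cmod (lin_ext (a (of_real s)) (Q n)))\<^sup>2)"
  shows "summable (\<lambda>n. (cmod (lin_ext (a (of_real t)) (Q n)))\<^sup>2)"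
    and "(\<Sum>n. (cmod (lin_ext (a (of_real t)) (Q n)))\<^sup>2) \<le> (\<Sum>n. (cmod (lin_ext (a (of_real s)) (Q n)))\<^sup>2)"
proof -
  let ?S = "\<Sum>n. (cmod (lin_ext (a (of_real s)) (Q n)))\<^sup>2"
  define c where "c = - \<i> * (complex_of_real t - of_real s)"
  \<comment> \<open>Here it matters that \<open>s\<close> and \<open>t\<close> are real: conjugating
    the exponential inverts it.\<close>
  have cnj_c: "cnj c = - c" by (simp add: c_def)
  have norm_c: "cmod c = \<bar>t - s\<bar>"
    by (simp add: c_def norm_mult flip: of_real_diff)
  have "complex_of_real t \<in> ball (of_real s) r"
    using t(1) by (simp add: dist_norm norm_minus_commute flip: of_real_diff)
  then have lim: "(\<lambda>N. lin_ext (a (of_real s)) (p * exp_poly c N)) \<longlonglongrightarrow> lin_ext (a (of_real t)) p" for p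
    unfolding a_def c_def by (rule lin_ext_exp_poly_taylor[OF f])
  have bound: "(cmod (lin_ext (a (of_real t)) p))\<^sup>2 \<le> ?S * Re (lin_ext m (p * map_poly cnj p))" for p
  proof (rule LIMSEQ_le)
    show "(\<lambda>N. (cmod (lin_ext (a (of_real s)) (p * exp_poly c N)))\<^sup>2) \<longlonglongrightarrow> (cmod (lin_ext (a (of_real t)) p))\<^sup>2"
      by (intro tendsto_intros lim)
    have "(\<lambda>N. lin_ext m ((p * map_poly cnj p) * (exp_poly c N * exp_poly (- c) N)))
        \<longlonglongrightarrow> lin_ext m (p * map_poly cnj p)"
      using t(2) by (intro lin_ext_exp_poly_cancel[OF A]) (simp add: norm_c)
    then show "(\<lambda>N. ?S * Re (lin_ext m ((p * map_poly cnj p) * (exp_poly c N * exp_poly (- c) N))))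
        \<longlonglongrightarrow> ?S * Re (lin_ext m (p * map_poly cnj p))"
      by (intro tendsto_intros)
    have "(p * map_poly cnj p) * (exp_poly c N * exp_poly (- c) N) =
        (p * exp_poly c N) * map_poly cnj (p * exp_poly c N)" for N
      by (simp add: map_poly_cnj_mult map_poly_cnj_exp_poly cnj_c mult_ac)
    then have "(cmod (lin_ext (a (of_real s)) (p * exp_poly c n)))\<^sup>2 \<le>
        ?S * Re (lin_ext m ((p * map_poly cnj p) * (exp_poly c n * exp_poly (- c) n)))" for n
      using lin_ext_bounded[OF real orth deg sum, of "p * exp_poly c n"] by (simp only:)
    then show "\<exists>N. \<forall>n\<ge>N. (cmod (lin_ext (a (of_real s)) (p * exp_poly c n)))\<^sup>2 \<le>
        ?S * Re (lin_ext m ((p * map_poly cnj p) * (exp_poly c n * exp_poly (- c) n)))"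
      by blast
  qed
  show "summable (\<lambda>n. (cmod (lin_ext (a (of_real t)) (Q n)))\<^sup>2)"
    and "(\<Sum>n. (cmod (lin_ext (a (of_real t)) (Q n)))\<^sup>2) \<le> ?S"
    using summable_bessel[OF real orth bound] by blast+
qed

text \<open>The power of \<open>\<i>\<close> in front of the operator has modulus 1.\<close>

lemma cmod_chromatic_deriv:
  "cmod (chromatic_deriv M n f z) =
    cmod (lin_ext (\<lambda>k. \<i> ^ k * (deriv ^^ k) f z) (map_poly of_real (orth_poly M n)))"
  by (simp add: chromatic_deriv_def poly_iD_def lin_ext_def norm_mult norm_power_int
      degree_map_poly_of_real mult.assoc)

section \<open>Propagation of the sum along the real axis\<close>

theorem corollary4p13:
  fixes M :: "real poly \<Rightarrow> real" and f :: "complex \<Rightarrow> complex"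
  assumes "chromatic M" and "f \<in> L2 M"
  shows "(\<forall>t::real. summable (\<lambda>n. (cmod (chromatic_deriv M n f (of_real t)))\<^sup>2)) \<and>
         (\<forall>s t::real. (\<Sum>n. (cmod (chromatic_deriv M n f (of_real s)))\<^sup>2) =
                      (\<Sum>n. (cmod (chromatic_deriv M n f (of_real t)))\<^sup>2))"
proof -
  define Q where "Q n = map_poly complex_of_real (orth_poly M n)" for n
  define m where "m n = complex_of_real (moment M n)" for n
  define X where "X t n = (cmod (lin_ext (\<lambda>k. \<i> ^ k * (deriv ^^ k) f (complex_of_real t)) (Q n)))\<^sup>2"
    for t :: real and n
  have X: "X t n = (cmod (chromatic_deriv M n f (of_real t)))\<^sup>2" for t n
    by (simp add: X_def Q_def cmod_chromatic_deriv)
  have lin: "Vector_Spaces.linear Polynomial.smult (*) M"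
    using assms(1) by (simp add: chromatic_def)
  have P: "orthonormal_polys M (orth_poly M)"
    by (rule orthonormal_polys_orth_poly[OF assms(1)])
  have real: "map_poly cnj (Q k) = Q k" for k
    by (rule poly_eqI) (simp add: Q_def)
  have orth: "lin_ext m (Q k * Q l) = (if k = l then 1 else 0)" for k l
  proof -
    have "lin_ext m (Q k * Q l) = of_real (M (orth_poly M k * orth_poly M l))"
      unfolding m_def Q_def map_poly_of_real_mult[symmetric] lin_ext_of_real
      by (simp add: lin_ext_moment[OF lin])
    then show ?thesis using P by (auto simp: orthonormal_polys_def)
  qed
  have deg: "degree (Q k) = k" for k
    using P by (simp add: Q_def degree_map_poly_of_real orthonormal_polys_def)
  obtain A where A: "A > 0" "\<And>n. \<bar>moment M n\<bar> \<le> A ^ n * fact n"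
    using chromatic_moment_bound[OF assms(1)] by blast
  have mA: "cmod (m n) \<le> A ^ n * fact n" for n using A(2) by (simp add: m_def)
  obtain r where r: "r > 0" "\<And>z. \<bar>Im z\<bar> < r \<Longrightarrow> z \<in> strip (1 / (2 * rho M))"
    using strip_contains_real_nbhd[OF assms(1)] by blast
  have f: "f holomorphic_on ball (of_real s) r" for s :: real
  proof -
    have "ball (of_real s) r \<subseteq> strip (1 / (2 * rho M))"
    proof
      fix z assume "z \<in> ball (complex_of_real s) r"
      then have "\<bar>Im (z - of_real s)\<bar> < r"
        using abs_Im_le_cmod[of "z - of_real s"] by (simp add: dist_norm norm_minus_commute)
      then show "z \<in> strip (1 / (2 * rho M))" using r(2) by simp
    qed
    moreover have "f analytic_on strip (1 / (2 * rho M))"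
      using assms(2) by (simp add: L2_def)
    ultimately show ?thesis
      using analytic_imp_holomorphic holomorphic_on_subset by blast
  qed
  \<comment> \<open>Half of \<open>r\<close> keeps the new point inside the disc, and
    \<open>1 / (8 * A)\<close> makes \<open>4 * A * \<delta>\<close> at most 1/2. Neither depends on
    the base point.\<close>
  define \<delta> where "\<delta> = min (r / 2) (1 / (8 * A))"
  have "\<delta> > 0" using r(1) A(1) by (simp add: \<delta>_def)
  have le: "summable (X t) \<and> suminf (X t) \<le> suminf (X s)"
    if "summable (X s)" "\<bar>t - s\<bar> \<le> \<delta>" for s t
  proof -
    have "\<bar>t - s\<bar> < r" using that(2) r(1) by (simp add: \<delta>_def)
    moreover have "4 * A * \<bar>t - s\<bar> < 1"
    proof -
      have "4 * A * \<bar>t - s\<bar> \<le> 4 * A * (1 / (8 * A))"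
        using that(2) A(1) by (intro mult_left_mono) (auto simp: \<delta>_def)
      then show ?thesis using A(1) by simp
    qed
    ultimately show ?thesis
      using lin_ext_deriv_sums_le[OF real orth deg A(1) mA f, of t s] that(1) unfolding X_def by blast
  qed
  \<comment> \<open>The first application of \<open>le\<close> gives summability at
    \<open>t\<close>, which permits the second one back to \<open>s\<close>.\<close>
  have step: "summable (X t) \<and> suminf (X t) = suminf (X s)"
    if "summable (X s)" "\<bar>t - s\<bar> \<le> \<delta>" for s t
    using le[OF that] le[of t s] that(2) by (auto simp: abs_minus_commute intro: antisym)
  have reach: "summable (X t) \<and> suminf (X t) = suminf (X 0)" if "\<bar>t\<bar> \<le> real n * \<delta>" for n t
    using that
  proof (induction n arbitrary: t)
    case 0
    then show ?case using assms(2) X[of 0] by (simp add: L2_def)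
  next
    case (Suc n)
    \<comment> \<open>Dividing the segment from 0 to \<open>t\<close> into \<open>Suc n\<close>
      equal pieces, \<open>s\<close> is the last division point before \<open>t\<close>; each piece
      has length at most \<open>\<delta>\<close>.\<close>
    define s where "s = t * (real n / real (Suc n))"
    have "\<bar>s\<bar> = \<bar>t\<bar> / real (Suc n) * real n" by (simp add: s_def abs_mult)
    also have "\<dots> \<le> \<delta> * real n"
      using Suc.prems by (intro mult_right_mono) (auto simp: divide_le_eq mult.commute)
    finally have "\<bar>s\<bar> \<le> real n * \<delta>" by (simp add: mult.commute)
    moreover have "\<bar>t - s\<bar> \<le> \<delta>"
    proof -
      have "t - s = t / real (Suc n)" by (simp add: s_def field_simps)
      then show ?thesis using Suc.prems by (simp add: divide_le_eq mult.commute)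
    qed
    ultimately show ?case using Suc.IH[of s] step[of s t] by simp
  qed
  have "summable (X t) \<and> suminf (X t) = suminf (X 0)" for t
  proof -
    obtain n where "\<bar>t\<bar> < real n * \<delta>"
      using reals_Archimedean3[OF \<open>\<delta> > 0\<close>] by blast
    then show ?thesis using reach[of t n] by simp
  qed
  then show ?thesis unfolding X[symmetric] by metis
qed

end
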